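(* Let $x\in[0,1)$, let $\Theta$ be a (measurable) set of types $\theta=(\gamma,c,\sigma)$ with probability measure $\pi$, and let $\mu:[0,\infty)\to\mathbb R$, $\lambda:[0,\infty)\to[0,\infty)$. Assume: (I1) the insurer chooses contracts from the compact set $\mathcal K:=[0,p_{\max}]\times[0,\alpha_{\max}]\times[0,\beta_{\max}]$, where $0\le p_{\max}<\infty$, $0\le\alpha_{\max}<\infty$, $0\le\beta_{\max}<1$; (I2) efforts and the mean-field effort are restricted to $[0,E_{\max}]$ with $E_{\max}<\infty$; $\mu$ and $\lambda$ are continuous and convex on $[0,(1+x)E_{\max}]$; and $\gamma(\theta),c(\theta),\sigma(\theta)$ are measurable with $0<\gamma(\theta)\le\gamma_{\max}$, $0\le c(\theta)\le c_{\max}$, $0\le\sigma(\theta)\le\sigma_{\max}$ for all $\theta\in\Theta$, for some $\gamma_{\max},c_{\max},\sigma_{\max}\in(0,\infty)$ (consequently, for every $k\in\mathcal K$ the set $\mathcal M(k)$ of mean-field Nash equilibria induced by $k$ is nonempty). Let $\mathcal J:\mathcal K\to\mathbb R$ be an insurer performance criterion that is well defined and bounded above on $\mathcal K$, i.e. $\sup_{k\in\mathcal K}\mathcal J(k)<\infty$. Then for every $\varepsilon>0$ there exists an admissible contract $k_\varepsilon\in\mathcal K$ (an $\varepsilon$-optimal insurer contract under $\mathcal J$) such that $$\mathcal J(k_\varepsilon)\ge\sup_{k\in\mathcal K}\mathcal J(k)-\varepsilon.$$ The approximation is only at the level of the insurer's optimization; the lower-level responses to $k_\varepsilon$ are exact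 mean-field Nash equilibria, i.e. elements of $\mathcal M(k_\varepsilon)$.
   Context: For a contract $k=(p,\alpha,\beta)$, $e,\tilde m\in[0,E_{\max}]$ and $\theta\in\Theta$ define $$\mathrm{CE}^{\mathrm{out}}(e;\theta,\tilde m)=\mu(e+x\tilde m)+c(\theta)e+\tfrac12\gamma(\theta)\lambda(e+x\tilde m),$$ $$\mathrm{CE}^{\mathrm{in}}(e;\theta,\tilde m)=p+(c(\theta)-\alpha)e+\tfrac12\gamma(\theta)\alpha^2\sigma(\theta)^2+(1-\beta)\mu(e+x\tilde m)+\tfrac12\gamma(\theta)(1-\beta)^2\lambda(e+x\tilde m),$$ $U^{\mathrm{out}}=-\exp\{\gamma(\theta)\mathrm{CE}^{\mathrm{out}}\}$, $U^{\mathrm{in}}=-\exp\{\gamma(\theta)\mathrm{CE}^{\mathrm{in}}\}$, $E^{\mathrm{out}}(\theta;\tilde m)=\arg\min_{e\in[0,E_{\max}]}\mathrm{CE}^{\mathrm{out}}(e;\theta,\tilde m)$ and $E^{\mathrm{in}}(\theta;\tilde m)=\arg\min_{e\in[0,E_{\max}]}\mathrm{CE}^{\mathrm{in}}(e;\theta,\tilde m)$. $\mathcal M(k)$ is the set of mean-field Nash equilibria $M=(\tilde m,\{e^{\mathrm{in}}(\theta),e^{\mathrm{out}}(\theta),q(\theta)\}_{\theta\in\Theta})$, i.e. tuples with $\tilde m\in[0,E_{\max}]$ and measurable components such that (1) $e^{\mathrm{out}}(\theta)\in E^{\mathrm{out}}(\theta;\tilde m)$, $e^{\mathrm{in}}(\theta)\in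 E^{\mathrm{in}}(\theta;\tilde m)$ for every $\theta$; (2) $q(\theta)\in[0,1]$, $q(\theta)=1$ if $U^{\mathrm{in}}(e^{\mathrm{in}}(\theta);\theta,\tilde m)>U^{\mathrm{out}}(e^{\mathrm{out}}(\theta);\theta,\tilde m)$, $q(\theta)=0$ if the strict inequality is reversed, arbitrary in $[0,1]$ in case of equality; (3) $\tilde m=\int_\Theta[q(\theta)e^{\mathrm{in}}(\theta)+(1-q(\theta))e^{\mathrm{out}}(\theta)]\,d\pi(\theta)$. The insurer's per-capita expected profit is $$J(k;M)=\int_\Theta\big(p-\alpha e^{\mathrm{in}}(\theta)-\beta\mu(e^{\mathrm{in}}(\theta)+x\tilde m)\big)q(\theta)\,d\pi(\theta).$$ An insurer performance criterion is a measurable function $\mathcal J:\mathcal K\to\mathbb R$ that assigns to each contract $k$ a single payoff value used to evaluate it, possibly by aggregating or selecting from the equilibrium payoff set $\mathbb J(k)=\{J(k;M):M\in\mathcal M(k)\}$. It is well defined if $\mathcal J(k)$ is a finite real number for every $k\in\mathcal K$. *)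

theory Defs
  imports "HOL-Probability.Probability"
begin

text \<open>Agent types are triples \<open>(\<gamma>, c, \<sigma>)\<close>, contracts are triples \<open>(p, \<alpha>, \<beta>)\<close>. The type space
  \<open>\<Theta>\<close> is the underlying space of the measure \<open>\<pi>\<close>; its sigma-algebra is not fixed to be the
  Borel one, so measurability of the three coordinates is a genuine hypothesis on \<open>\<pi>\<close>.\<close>

type_synonym agent_type = "real \<times> real \<times> real"
type_synonym contract = "real \<times> real \<times> real"

fun \<gamma>_of :: "agent_type \<Rightarrow> real" where "\<gamma>_of (\<gamma>, c, \<sigma>) = \<gamma>"
fun c_of :: "agent_type \<Rightarrow> real" where "c_of (\<gamma>, c, \<sigma>) = c"
fun \<sigma>_of :: "agent_type \<Rightarrow> real" where "\<sigma>_of (\<gamma>, c, \<sigma>) = \<sigma>"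

definition contracts :: "real \<Rightarrow> real \<Rightarrow> real \<Rightarrow> contract set" where
  "contracts p_max \<alpha>_max \<beta>_max = {0..p_max} \<times> {0..\<alpha>_max} \<times> {0..\<beta>_max}"

text \<open>The argument \<open>lam\<close> stands for the function \<open>\<lambda>\<close>, which is reserved syntax.\<close>

definition CE_out ::
  "(real \<Rightarrow> real) \<Rightarrow> (real \<Rightarrow> real) \<Rightarrow> real \<Rightarrow> real \<Rightarrow> agent_type \<Rightarrow> real \<Rightarrow> real" where
  "CE_out \<mu> lam x e \<theta> m =
     \<mu> (e + x * m) + c_of \<theta> * e + 1/2 * \<gamma>_of \<theta> * lam (e + x * m)"

fun CE_in ::
  "(real \<Rightarrow> real) \<Rightarrow> (real \<Rightarrow> real) \<Rightarrow> real \<Rightarrow> contract \<Rightarrow> real \<Rightarrow> agent_type \<Rightarrow> real \<Rightarrow> real" where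
  "CE_in \<mu> lam x (p, \<alpha>, \<beta>) e \<theta> m =
     p + (c_of \<theta> - \<alpha>) * e + 1/2 * \<gamma>_of \<theta> * \<alpha>\<^sup>2 * (\<sigma>_of \<theta>)\<^sup>2
       + (1 - \<beta>) * \<mu> (e + x * m) + 1/2 * \<gamma>_of \<theta> * (1 - \<beta>)\<^sup>2 * lam (e + x * m)"

definition U_out ::
  "(real \<Rightarrow> real) \<Rightarrow> (real \<Rightarrow> real) \<Rightarrow> real \<Rightarrow> real \<Rightarrow> agent_type \<Rightarrow> real \<Rightarrow> real" where
  "U_out \<mu> lam x e \<theta> m = - exp (\<gamma>_of \<theta> * CE_out \<mu> lam x e \<theta> m)"

definition U_in ::
  "(real \<Rightarrow> real) \<Rightarrow> (real \<Rightarrow> real) \<Rightarrow> real \<Rightarrow> contract \<Rightarrow> real \<Rightarrow> agent_type \<Rightarrow> real \<Rightarrow> real" where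
  "U_in \<mu> lam x k e \<theta> m = - exp (\<gamma>_of \<theta> * CE_in \<mu> lam x k e \<theta> m)"

definition E_out ::
  "(real \<Rightarrow> real) \<Rightarrow> (real \<Rightarrow> real) \<Rightarrow> real \<Rightarrow> real \<Rightarrow> agent_type \<Rightarrow> real \<Rightarrow> real set" where
  "E_out \<mu> lam x E_max \<theta> m =
     {e. is_arg_min (\<lambda>e. CE_out \<mu> lam x e \<theta> m) (\<lambda>e. e \<in> {0..E_max}) e}"

definition E_in ::
  "(real \<Rightarrow> real) \<Rightarrow> (real \<Rightarrow> real) \<Rightarrow> real \<Rightarrow> real \<Rightarrow> contract \<Rightarrow> agent_type \<Rightarrow> real \<Rightarrow> real set" where
  "E_in \<mu> lam x E_max k \<theta> m =
     {e. is_arg_min (\<lambda>e. CE_in \<mu> lam x k e \<theta> m) (\<lambda>e. e \<in> {0..E_max}) e}"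

record mf_profile =
  mean_effort :: real
  eff_in :: "agent_type \<Rightarrow> real"
  eff_out :: "agent_type \<Rightarrow> real"
  participation :: "agent_type \<Rightarrow> real"

definition mf_equilibria ::
  "agent_type measure \<Rightarrow> (real \<Rightarrow> real) \<Rightarrow> (real \<Rightarrow> real) \<Rightarrow> real \<Rightarrow> real \<Rightarrow> contract \<Rightarrow> mf_profile set"
where
  "mf_equilibria \<pi> \<mu> lam x E_max k =
    {M. let m = mean_effort M; e_in = eff_in M; e_out = eff_out M; q = participation M in
        m \<in> {0..E_max}
      \<and> e_in \<in> borel_measurable \<pi> \<and> e_out \<in> borel_measurable \<pi> \<and> q \<in> borel_measurable \<pi>
      \<and> (\<forall>\<theta>\<in>space \<pi>. e_out \<theta> \<in> E_out \<mu> lam x E_max \<theta> m \<and> e_in \<theta> \<in> E_in \<mu> lam x E_max k \<theta> m)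
      \<and> (\<forall>\<theta>\<in>space \<pi>. q \<theta> \<in> {0..1}
           \<and> (U_in \<mu> lam x k (e_in \<theta>) \<theta> m > U_out \<mu> lam x (e_out \<theta>) \<theta> m \<longrightarrow> q \<theta> = 1)
           \<and> (U_in \<mu> lam x k (e_in \<theta>) \<theta> m < U_out \<mu> lam x (e_out \<theta>) \<theta> m \<longrightarrow> q \<theta> = 0))
      \<and> m = (\<integral>\<theta>. q \<theta> * e_in \<theta> + (1 - q \<theta>) * e_out \<theta> \<partial>\<pi>)}"

fun profit ::
  "agent_type measure \<Rightarrow> (real \<Rightarrow> real) \<Rightarrow> real \<Rightarrow> contract \<Rightarrow> mf_profile \<Rightarrow> real" where
  "profit \<pi> \<mu> x (p, \<alpha>, \<beta>) M =
     (\<integral>\<theta>. (p - \<alpha> * eff_in M \<theta> - \<beta> * \<mu> (eff_in M \<theta> + x * mean_effort M))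
            * participation M \<theta> \<partial>\<pi>)"

definition payoff_set ::
  "agent_type measure \<Rightarrow> (real \<Rightarrow> real) \<Rightarrow> (real \<Rightarrow> real) \<Rightarrow> real \<Rightarrow> real \<Rightarrow> contract \<Rightarrow> real set" where
  "payoff_set \<pi> \<mu> lam x E_max k = profit \<pi> \<mu> x k ` mf_equilibria \<pi> \<mu> lam x E_max k"

text \<open>A criterion may, but need not, be obtained by aggregating or selecting from the payoff set
  of each contract, so measurability on the contract set is the only requirement. Finiteness of
  its values (well-definedness) is expressed by the codomain \<open>real\<close>.\<close>

definition performance_criterion :: "contract set \<Rightarrow> (contract \<Rightarrow> real) \<Rightarrow> bool" where
  "performance_criterion K J \<longleftrightarrow> J \<in> borel_measurable (restrict_space borel K)"

end

theory Submission
  imports Defs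
begin

text \<open>The \<open>\<epsilon>\<close>-optimal contract is immediate from the definition of the supremum; the substance is
  the existence of an equilibrium for every contract. For a given mean effort, a type chooses
  effort and participation so as to minimise \<open>F = min CE_in CE_out\<close>, which is jointly continuous in
  effort and mean effort. The least and greatest minimisers of \<open>F\<close> are measurable in the type and
  lower, respectively upper, semicontinuous in the mean effort \<open>m\<close>, so by Fatou the same holds for
  their integrals \<open>L(m) \<le> R(m)\<close>. The supremum \<open>m\<close> of all points with \<open>m \<le> R(m)\<close> then satisfies
  \<open>L(m) \<le> m \<le> R(m)\<close>, a one-dimensional Kakutani argument. Interpolating linearly between the
  profiles realising \<open>L(m)\<close> and \<open>R(m)\<close> preserves optimality, by convexity of the costs, and the
  intermediate value theorem gives a profile with mean exactly \<open>m\<close>.\<close>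

section \<open>Sets of minimisers on compact and on convex sets\<close>

definition argmins :: "'a set \<Rightarrow> ('a \<Rightarrow> real) \<Rightarrow> 'a set" where
  "argmins S h = {e \<in> S. \<forall>y\<in>S. h e \<le> h y}"

text \<open>Translates the response sets \<open>E_in\<close> and \<open>E_out\<close> into the form
  in which compactness, convexity and extreme points of minimiser sets are studied.\<close>

lemma is_arg_min_iff_argmins: "is_arg_min h (\<lambda>e. e \<in> S) e \<longleftrightarrow> e \<in> argmins S h"
  by (auto simp: is_arg_min_def argmins_def not_less)

text \<open>The minimum is attained at some \<open>e0\<close>, so the minimisers are the sublevel
  set at level \<open>h e0\<close>, which is closed inside the compact \<open>S\<close>.\<close>

lemma compact_argmins:
  fixes h :: "'a::t2_space \<Rightarrow> real"
  assumes S: "compact S" "S \<noteq> {}" and h: "continuous_on S h"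
  shows "compact (argmins S h)" "argmins S h \<noteq> {}"
proof -
  obtain e0 where e0: "e0 \<in> S" "\<forall>y\<in>S. h e0 \<le> h y"
    using continuous_attains_inf[OF S h] by blast
  have eq: "argmins S h = {e \<in> S. h e \<le> h e0}"
    using e0 by (force simp: argmins_def)
  have "closed {e \<in> S. h e \<le> h e0}"
    using S h by (intro continuous_on_closed_Collect_le continuous_on_const compact_imp_closed)
  then have "compact (S \<inter> {e \<in> S. h e \<le> h e0})"
    using S by (intro compact_Int_closed)
  then show "compact (argmins S h)"
    unfolding eq by (simp add: Int_def)
  show "argmins S h \<noteq> {}"
    using e0 by (auto simp: argmins_def)
qed

lemma
  fixes h :: "real \<Rightarrow> real"
  assumes "compact S" "S \<noteq> {}" "continuous_on S h"
  shows Inf_argmins_in: "Inf (argmins S h) \<in> argmins S h"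
    and Sup_argmins_in: "Sup (argmins S h) \<in> argmins S h"
    and bdd_below_argmins: "bdd_below (argmins S h)"
    and bdd_above_argmins: "bdd_above (argmins S h)"
proof -
  note A = compact_argmins[OF assms]
  show b: "bdd_below (argmins S h)" "bdd_above (argmins S h)"
    using A(1) by (auto intro: bounded_imp_bdd_below bounded_imp_bdd_above compact_imp_bounded)
  show "Inf (argmins S h) \<in> argmins S h" "Sup (argmins S h) \<in> argmins S h"
    using A b by (auto intro!: closed_contains_Inf closed_contains_Sup compact_imp_closed)
qed

lemma convex_argmins:
  assumes "convex_on S h"
  shows "convex (argmins S h)"
proof (rule convexI)
  fix e e' and u v :: real
  assume e: "e \<in> argmins S h" "e' \<in> argmins S h" and uv: "0 \<le> u" "0 \<le> v" "u + v = 1"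
  have S: "u *\<^sub>R e + v *\<^sub>R e' \<in> S"
    using e uv convex_on_imp_convex[OF assms] by (auto simp: argmins_def convex_def)
  have "h (u *\<^sub>R e + v *\<^sub>R e') \<le> u * h e + v * h e'"
    using assms e uv by (auto simp: convex_on_def argmins_def)
  also have "\<dots> \<le> u * h y + v * h y" if "y \<in> S" for y
    using e uv that by (auto simp: argmins_def intro!: add_mono mult_left_mono)
  also have "u * h y + v * h y = h y" for y
    using uv by (metis distrib_right mult_1)
  finally show "u *\<^sub>R e + v *\<^sub>R e' \<in> argmins S h"
    using S by (auto simp: argmins_def)
qed

lemma bdd_below_continuous_image:
  fixes h :: "'a::topological_space \<Rightarrow> real"
  assumes "compact S" "continuous_on S h"
  shows "bdd_below (h ` S)"
  using assms by (simp add: bounded_imp_bdd_below compact_continuous_image compact_imp_bounded)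

text \<open>Lets minimal values be handled as infima, whose measurability in a parameter can be
  proved without choosing a minimiser.\<close>

lemma argmins_value:
  fixes h :: "'a \<Rightarrow> real"
  assumes "e \<in> argmins S h"
  shows "(INF y\<in>S. h y) = h e"
proof (rule antisym)
  have "bdd_below (h ` S)"
    using assms by (auto simp: argmins_def intro: bdd_belowI)
  then show "(INF y\<in>S. h y) \<le> h e"
    using assms by (auto simp: argmins_def intro: cINF_lower)
  show "h e \<le> (INF y\<in>S. h y)"
    using assms by (auto simp: argmins_def intro!: cINF_greatest)
qed

section \<open>Measurability of the least and greatest minimiser\<close>

lemma borel_measurable_INF_compact:
  fixes h :: "'a \<Rightarrow> 'b::euclidean_space \<Rightarrow> real"
  assumes S: "compact S" "S \<noteq> {}"
    and cont: "\<And>\<omega>. \<omega> \<in> space M \<Longrightarrow> continuous_on S (h \<omega>)"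
    and meas: "\<And>e. e \<in> S \<Longrightarrow> (\<lambda>\<omega>. h \<omega> e) \<in> borel_measurable M"
  shows "(\<lambda>\<omega>. INF e\<in>S. h \<omega> e) \<in> borel_measurable M"
proof -
  \<comment> \<open>By continuity the infimum over \<open>S\<close> equals the infimum over a
    countable dense subset, and a countable infimum of measurable functions is measurable.\<close>
  obtain D where D: "countable D" "D \<subseteq> S" "S \<subseteq> closure D"
    using separable by blast
  have cl: "closure D = S"
    using D S by (simp add: antisym closure_minimal compact_imp_closed)
  have "D \<noteq> {}"
    using D S by auto
  have bdd: "bdd_below (h \<omega> ` S)" "bdd_below (h \<omega> ` D)" if "\<omega> \<in> space M" for \<omega>
  proof -
    show "bdd_below (h \<omega> ` S)"
      by (rule bdd_below_continuous_image[OF S(1) cont[OF that]])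
    then show "bdd_below (h \<omega> ` D)"
      by (rule bdd_below_mono) (use D(2) in auto)
  qed
  have "(INF e\<in>S. h \<omega> e) = (INF e\<in>D. h \<omega> e)" if \<omega>: "\<omega> \<in> space M" for \<omega>
  proof (rule antisym)
    show "(INF e\<in>S. h \<omega> e) \<le> (INF e\<in>D. h \<omega> e)"
      using D \<open>D \<noteq> {}\<close> bdd[OF \<omega>] by (intro cINF_superset_mono) auto
    have "(INF e\<in>D. h \<omega> e) \<le> h \<omega> e" if "e \<in> S" for e
      using continuous_ge_on_closure[of D "h \<omega>" e] cont[OF \<omega>] that cl cINF_lower[OF bdd(2)[OF \<omega>]]
      by simp
    then show "(INF e\<in>D. h \<omega> e) \<le> (INF e\<in>S. h \<omega> e)"
      using S by (intro cINF_greatest) auto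
  qed
  moreover have "(\<lambda>\<omega>. INF e\<in>D. h \<omega> e) \<in> borel_measurable M"
    using D bdd meas by (intro borel_measurable_cINF) auto
  ultimately show ?thesis
    by (simp cong: measurable_cong)
qed

text \<open>For \<open>0 \<le> t < E\<close> the least minimiser is at most \<open>t\<close> exactly
  when the minimum over \<open>{0..t}\<close> does not exceed the minimum over
  \<open>{0..E}\<close>. Both minima are measurable in the parameter, and hence so is each sublevel
  set.\<close>

lemma Inf_argmins_measurable:
  fixes h :: "'a \<Rightarrow> real \<Rightarrow> real"
  assumes E: "0 \<le> E"
    and cont: "\<And>\<omega>. \<omega> \<in> space M \<Longrightarrow> continuous_on {0..E} (h \<omega>)"
    and meas: "\<And>e. e \<in> {0..E} \<Longrightarrow> (\<lambda>\<omega>. h \<omega> e) \<in> borel_measurable M"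
  shows "(\<lambda>\<omega>. Inf (argmins {0..E} (h \<omega>))) \<in> borel_measurable M"
  unfolding borel_measurable_iff_le
proof
  fix t
  let ?L = "\<lambda>\<omega>. Inf (argmins {0..E} (h \<omega>))"
  have L: "?L \<omega> \<in> argmins {0..E} (h \<omega>)" if "\<omega> \<in> space M" for \<omega>
    using E cont[OF that] by (intro Inf_argmins_in) auto
  then have rng: "0 \<le> ?L \<omega>" "?L \<omega> \<le> E" if "\<omega> \<in> space M" for \<omega>
    using that by (auto simp: argmins_def)
  \<comment> \<open>The comparison of minima needs \<open>{0..t}\<close> to be a nonempty subset of
    \<open>{0..E}\<close>; for the remaining \<open>t\<close> the sublevel set is empty or the whole
    space.\<close>
  consider "t < 0" | "E \<le> t" | "0 \<le> t" "t < E" by linarith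
  then show "{\<omega> \<in> space M. ?L \<omega> \<le> t} \<in> sets M"
  proof cases
    case 1
    then have "{\<omega> \<in> space M. ?L \<omega> \<le> t} = {}" using rng by force
    then show ?thesis by (metis sets.empty_sets)
  next
    case 2
    then have "{\<omega> \<in> space M. ?L \<omega> \<le> t} = space M" using rng by force
    then show ?thesis by simp
  next
    case 3
    have ct: "continuous_on {0..t} (h \<omega>)" if "\<omega> \<in> space M" for \<omega>
      using 3 by (intro continuous_on_subset[OF cont[OF that]]) auto
    have "?L \<omega> \<le> t \<longleftrightarrow> (INF e\<in>{0..t}. h \<omega> e) \<le> (INF e\<in>{0..E}. h \<omega> e)"
      if \<omega>: "\<omega> \<in> space M" for \<omega>
    proof
      assume "?L \<omega> \<le> t"
      then have "(INF e\<in>{0..t}. h \<omega> e) \<le> h \<omega> (?L \<omega>)"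
        using rng[OF \<omega>] by (intro cINF_lower bdd_below_continuous_image ct \<omega>) auto
      then show "(INF e\<in>{0..t}. h \<omega> e) \<le> (INF e\<in>{0..E}. h \<omega> e)"
        by (simp add: argmins_value[OF L[OF \<omega>]])
    next
      assume le: "(INF e\<in>{0..t}. h \<omega> e) \<le> (INF e\<in>{0..E}. h \<omega> e)"
      obtain e where e: "e \<in> argmins {0..t} (h \<omega>)"
        using compact_argmins(2)[OF _ _ ct[OF \<omega>]] 3 by auto
      \<comment> \<open>A minimiser over the short interval that reaches the global minimum is a
        global minimiser, so the least one cannot lie beyond it.\<close>
      have "h \<omega> e \<le> h \<omega> (?L \<omega>)"
        using le argmins_value[OF e] argmins_value[OF L[OF \<omega>]] by simp
      then have "e \<in> argmins {0..E} (h \<omega>)"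
        using L[OF \<omega>] e 3 by (force simp: argmins_def)
      then have "?L \<omega> \<le> e"
        using E cont[OF \<omega>] by (intro cInf_lower bdd_below_argmins) auto
      then show "?L \<omega> \<le> t" using e by (auto simp: argmins_def)
    qed
    then have eq: "{\<omega> \<in> space M. ?L \<omega> \<le> t} =
        {\<omega> \<in> space M. (INF e\<in>{0..t}. h \<omega> e) \<le> (INF e\<in>{0..E}. h \<omega> e)}"
      by auto
    have [measurable]: "(\<lambda>\<omega>. INF e\<in>{0..t}. h \<omega> e) \<in> borel_measurable M"
      using 3 ct meas by (intro borel_measurable_INF_compact) auto
    have [measurable]: "(\<lambda>\<omega>. INF e\<in>{0..E}. h \<omega> e) \<in> borel_measurable M"
      using E cont meas by (intro borel_measurable_INF_compact) auto
    show ?thesis unfolding eq by measurable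
  qed
qed

text \<open>The reflection of \<open>{0..E}\<close> exchanges least and greatest minimisers, so
  facts about \<open>Sup\<close> follow from those about \<open>Inf\<close>.\<close>

lemma argmins_reflect:
  fixes h :: "real \<Rightarrow> real"
  shows "argmins {0..E} (\<lambda>e. h (E - e)) = (\<lambda>e. E - e) ` argmins {0..E} h"
proof -
  have "e \<in> argmins {0..E} (\<lambda>e. h (E - e)) \<longleftrightarrow> E - e \<in> argmins {0..E} h" for e
  proof -
    have "(\<forall>y\<in>{0..E}. h (E - e) \<le> h (E - y)) \<longleftrightarrow> (\<forall>y\<in>(\<lambda>y. E - y) ` {0..E}. h (E - e) \<le> h y)"
      by blast
    then show ?thesis by (auto simp: argmins_def)
  qed
  then show ?thesis
    by (force simp: image_iff)
qed

lemma Inf_argmins_reflect: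
  fixes h :: "real \<Rightarrow> real"
  assumes "0 \<le> E" "continuous_on {0..E} h"
  shows "Inf (argmins {0..E} (\<lambda>e. h (E - e))) = E - Sup (argmins {0..E} h)"
proof (rule cInf_eq_minimum)
  have S: "Sup (argmins {0..E} h) \<in> argmins {0..E} h"
    using assms by (intro Sup_argmins_in) auto
  then show "E - Sup (argmins {0..E} h) \<in> argmins {0..E} (\<lambda>e. h (E - e))"
    unfolding argmins_reflect by blast
  have "e \<le> Sup (argmins {0..E} h)" if "e \<in> argmins {0..E} h" for e
    using assms that by (intro cSup_upper bdd_above_argmins) auto
  then show "E - Sup (argmins {0..E} h) \<le> e" if "e \<in> argmins {0..E} (\<lambda>e. h (E - e))" for e
    using that unfolding argmins_reflect by auto
qed

lemma continuous_on_reflect: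
  fixes h :: "real \<Rightarrow> real"
  assumes "continuous_on {0..E} h"
  shows "continuous_on {0..E} (\<lambda>e. h (E - e))"
  by (rule continuous_on_compose2[OF assms]) (auto intro!: continuous_intros)

lemma Sup_argmins_measurable:
  fixes h :: "'a \<Rightarrow> real \<Rightarrow> real"
  assumes E: "0 \<le> E"
    and cont: "\<And>\<omega>. \<omega> \<in> space M \<Longrightarrow> continuous_on {0..E} (h \<omega>)"
    and meas: "\<And>e. e \<in> {0..E} \<Longrightarrow> (\<lambda>\<omega>. h \<omega> e) \<in> borel_measurable M"
  shows "(\<lambda>\<omega>. Sup (argmins {0..E} (h \<omega>))) \<in> borel_measurable M"
proof -
  have "(\<lambda>\<omega>. E - Inf (argmins {0..E} (\<lambda>e. h \<omega> (E - e)))) \<in> borel_measurable M"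
    using E meas by (intro borel_measurable_diff borel_measurable_const Inf_argmins_measurable
        continuous_on_reflect cont) auto
  then show ?thesis
    by (simp add: Inf_argmins_reflect[OF E cont] cong: measurable_cong)
qed

section \<open>Semicontinuity and the one-dimensional fixed point\<close>

lemma Inf_argmins_lower_semicontinuous:
  fixes h :: "real \<times> real \<Rightarrow> real"
  assumes E: "0 \<le> E" and cont: "continuous_on ({0..E} \<times> {0..E}) h"
    and s: "\<And>n. s n \<in> {0..E}" "s \<longlonglongrightarrow> m" "m \<in> {0..E}"
    and y: "y < Inf (argmins {0..E} (\<lambda>e. h (e, m)))"
  shows "\<forall>\<^sub>F n in sequentially. y < Inf (argmins {0..E} (\<lambda>e. h (e, s n)))"
proof (rule ccontr)
  let ?L = "\<lambda>m. Inf (argmins {0..E} (\<lambda>e. h (e, m)))"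
  have c: "continuous_on {0..E} (\<lambda>e. h (e, m))" if "m \<in> {0..E}" for m
    using that by (intro continuous_on_compose2[OF cont]) (auto intro!: continuous_intros)
  have L: "?L m \<in> argmins {0..E} (\<lambda>e. h (e, m))" if "m \<in> {0..E}" for m
    using E c[OF that] by (intro Inf_argmins_in) auto
  \<comment> \<open>Infinitely many of the least minimisers then stay at or below \<open>y\<close>,
    and by compactness a subsequence of them converges to some \<open>e \<le> y\<close>. Joint
    continuity makes \<open>e\<close> a minimiser at \<open>m\<close>, so
    \<open>?L m \<le> e \<le> y\<close>, against the choice of \<open>y\<close>.\<close>
  assume "\<not> (\<forall>\<^sub>F n in sequentially. y < ?L (s n))"
  then have "infinite {n. \<not> y < ?L (s n)}"
    by (auto simp: frequently_cofinite not_eventually simp flip: cofinite_eq_sequentially)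
  then obtain r where r: "strict_mono (r :: nat \<Rightarrow> nat)" "\<And>n. \<not> y < ?L (s (r n))"
    using infinite_enumerate[of "{n. \<not> y < ?L (s n)}"] by auto
  have "\<forall>n. ?L (s (r n)) \<in> {0..E}"
    using L[OF s(1)] by (auto simp: argmins_def)
  then obtain e r' where e: "e \<in> {0..E}" and r': "strict_mono (r' :: nat \<Rightarrow> nat)"
    and lim: "((\<lambda>n. ?L (s (r n))) \<circ> r') \<longlonglongrightarrow> e"
    using compact_Icc[of 0 E] unfolding compact_def by (metis (no_types, lifting))
  let ?k = "r \<circ> r'"
  have k: "strict_mono ?k" using r(1) r' by (rule strict_mono_o)
  have sk: "(\<lambda>n. s (?k n)) \<longlonglongrightarrow> m"
    using LIMSEQ_subseq_LIMSEQ[OF s(2) k] by (simp add: o_def)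
  have Lk: "(\<lambda>n. ?L (s (?k n))) \<longlonglongrightarrow> e"
    using lim by (simp add: o_def)
  have "h (e, m) \<le> h (z, m)" if z: "z \<in> {0..E}" for z
  proof (rule LIMSEQ_le)
    show "(\<lambda>n. h (?L (s (?k n)), s (?k n))) \<longlonglongrightarrow> h (e, m)"
      using L[OF s(1)] s e
      by (intro continuous_on_tendsto_compose[OF cont] tendsto_Pair Lk sk)
        (auto simp: argmins_def)
    show "(\<lambda>n. h (z, s (?k n))) \<longlonglongrightarrow> h (z, m)"
      using s z by (intro continuous_on_tendsto_compose[OF cont] tendsto_Pair tendsto_const sk) auto
    show "\<exists>N. \<forall>n\<ge>N. h (?L (s (?k n)), s (?k n)) \<le> h (z, s (?k n))"
      using L[OF s(1)] z by (auto simp: argmins_def)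
  qed
  then have "e \<in> argmins {0..E} (\<lambda>e. h (e, m))"
    using e by (auto simp: argmins_def)
  then have "?L m \<le> e"
    using E c[OF s(3)] by (intro cInf_lower bdd_below_argmins) auto
  moreover have "e \<le> y"
    using r(2) by (intro LIMSEQ_le_const2[OF Lk]) (auto simp: not_less)
  ultimately show False using y by simp
qed


text \<open>Fatou's lemma for the lower semicontinuous least minimiser. The bounds
  \<open>c n\<close> are kept separate from the points \<open>s n\<close> so that the reflected
  problem, with bounds \<open>E - s n\<close>, is covered as well.\<close>

lemma (in prob_space) integral_Inf_argmins_le_limit:
  fixes F :: "'a \<Rightarrow> real \<times> real \<Rightarrow> real"
  assumes E: "0 \<le> E"
    and cont: "\<And>\<omega>. \<omega> \<in> space M \<Longrightarrow> continuous_on ({0..E} \<times> {0..E}) (F \<omega>)"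
    and meas: "\<And>e m. e \<in> {0..E} \<Longrightarrow> m \<in> {0..E} \<Longrightarrow> (\<lambda>\<omega>. F \<omega> (e, m)) \<in> borel_measurable M"
    and s: "\<And>n. s n \<in> {0..E}" "s \<longlonglongrightarrow> m" "m \<in> {0..E}"
    and le: "\<And>n. (\<integral>\<omega>. Inf (argmins {0..E} (\<lambda>e. F \<omega> (e, s n))) \<partial>M) \<le> c n"
    and c: "c \<longlonglongrightarrow> C"
  shows "(\<integral>\<omega>. Inf (argmins {0..E} (\<lambda>e. F \<omega> (e, m))) \<partial>M) \<le> C"
proof -
  let ?L = "\<lambda>m \<omega>. Inf (argmins {0..E} (\<lambda>e. F \<omega> (e, m)))"
  have cm: "continuous_on {0..E} (\<lambda>e. F \<omega> (e, m))" if "m \<in> {0..E}" "\<omega> \<in> space M" for m \<omega>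
    using that by (intro continuous_on_compose2[OF cont]) (auto intro!: continuous_intros)
  have L: "?L m \<omega> \<in> {0..E}" if "m \<in> {0..E}" "\<omega> \<in> space M" for m \<omega>
    using Inf_argmins_in[OF _ _ cm[OF that]] E by (auto simp: argmins_def)
  have Lm: "?L m \<in> borel_measurable M" if "m \<in> {0..E}" for m
    using E cm[OF that] meas that by (intro Inf_argmins_measurable) auto
  \<comment> \<open>Fatou's lemma is used in its nonnegative form; since the minimisers lie in
    \<open>{0..E}\<close>, both integrals agree and are finite.\<close>
  have nn: "(\<integral>\<^sup>+\<omega>. ennreal (?L m \<omega>) \<partial>M) = ennreal (\<integral>\<omega>. ?L m \<omega> \<partial>M)" if "m \<in> {0..E}" for m
    using L[OF that] Lm[OF that]
    by (intro nn_integral_eq_integral integrable_const_bound[where B = E] AE_I2) auto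
  \<comment> \<open>As \<open>ennreal\<close> sends negative reals to 0, the return to the reals at
    the end requires \<open>0 \<le> C\<close>.\<close>
  have "0 \<le> (\<integral>\<omega>. ?L (s n) \<omega> \<partial>M)" for n
    using L[OF s(1)] by (intro Bochner_Integration.integral_nonneg) auto
  then have cn: "0 \<le> c n" for n
    using le order_trans by blast
  then have C: "0 \<le> C"
    using c by (intro LIMSEQ_le_const) auto
  have "ennreal (\<integral>\<omega>. ?L m \<omega> \<partial>M) = (\<integral>\<^sup>+\<omega>. ennreal (?L m \<omega>) \<partial>M)"
    using nn[OF s(3)] by simp
  also have "\<dots> \<le> (\<integral>\<^sup>+\<omega>. liminf (\<lambda>n. ennreal (?L (s n) \<omega>)) \<partial>M)"
  proof (rule nn_integral_mono)
    fix \<omega> assume \<omega>: "\<omega> \<in> space M"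
    show "ennreal (?L m \<omega>) \<le> liminf (\<lambda>n. ennreal (?L (s n) \<omega>))"
      unfolding le_Liminf_iff
    proof safe
      fix y assume y: "y < ennreal (?L m \<omega>)"
      then obtain z where z: "y = ennreal z" "0 \<le> z"
        by (cases y) (auto simp: top_unique)
      have "\<forall>\<^sub>F n in sequentially. z < ?L (s n) \<omega>"
        using y z cont[OF \<omega>] s E
        by (intro Inf_argmins_lower_semicontinuous) (auto simp: ennreal_less_iff)
      then show "\<forall>\<^sub>F n in sequentially. y < ennreal (?L (s n) \<omega>)"
        using z by (auto simp: ennreal_less_iff elim: eventually_mono)
    qed
  qed
  also have "\<dots> \<le> liminf (\<lambda>n. \<integral>\<^sup>+\<omega>. ennreal (?L (s n) \<omega>) \<partial>M)"
    using Lm[OF s(1)] by (intro nn_integral_liminf) auto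
  also have "\<dots> \<le> liminf (\<lambda>n. ennreal (c n))"
    using nn[OF s(1)] le by (intro Liminf_mono) (auto intro!: always_eventually ennreal_leI)
  also have "\<dots> = ennreal C"
    using c by (intro lim_imp_Liminf tendsto_ennrealI) auto
  finally show ?thesis using C by simp
qed

lemma (in prob_space) ex_mean_between_integrals:
  fixes F :: "'a \<Rightarrow> real \<times> real \<Rightarrow> real"
  assumes E: "0 \<le> E"
    and cont: "\<And>\<omega>. \<omega> \<in> space M \<Longrightarrow> continuous_on ({0..E} \<times> {0..E}) (F \<omega>)"
    and meas: "\<And>e m. e \<in> {0..E} \<Longrightarrow> m \<in> {0..E} \<Longrightarrow> (\<lambda>\<omega>. F \<omega> (e, m)) \<in> borel_measurable M"
  obtains m where "m \<in> {0..E}"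
    "(\<integral>\<omega>. Inf (argmins {0..E} (\<lambda>e. F \<omega> (e, m))) \<partial>M) \<le> m"
    "m \<le> (\<integral>\<omega>. Sup (argmins {0..E} (\<lambda>e. F \<omega> (e, m))) \<partial>M)"
proof -
  let ?L = "\<lambda>m \<omega>. Inf (argmins {0..E} (\<lambda>e. F \<omega> (e, m)))"
  let ?R = "\<lambda>m \<omega>. Sup (argmins {0..E} (\<lambda>e. F \<omega> (e, m)))"
  have cm: "continuous_on {0..E} (\<lambda>e. F \<omega> (e, m))" if "m \<in> {0..E}" "\<omega> \<in> space M" for m \<omega>
    using that by (intro continuous_on_compose2[OF cont]) (auto intro!: continuous_intros)
  have L: "?L m \<omega> \<in> {0..E}" and R: "?R m \<omega> \<in> {0..E}" and LR: "?L m \<omega> \<le> ?R m \<omega>"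
    if "m \<in> {0..E}" "\<omega> \<in> space M" for m \<omega>
  proof -
    have "?L m \<omega> \<in> argmins {0..E} (\<lambda>e. F \<omega> (e, m))" "?R m \<omega> \<in> argmins {0..E} (\<lambda>e. F \<omega> (e, m))"
      using Inf_argmins_in[OF _ _ cm[OF that]] Sup_argmins_in[OF _ _ cm[OF that]] E by auto
    moreover from this show "?L m \<omega> \<in> {0..E}" "?R m \<omega> \<in> {0..E}"
      by (auto simp: argmins_def)
    ultimately show "?L m \<omega> \<le> ?R m \<omega>"
      using bdd_below_argmins[OF _ _ cm[OF that]] E by (intro cInf_lower) auto
  qed
  have Li: "integrable M (?L m)" and Ri: "integrable M (?R m)" if "m \<in> {0..E}" for m
    using E cm[OF that] meas that L[OF that] R[OF that]
    by (auto intro!: integrable_const_bound[where B = E] AE_I2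
        Inf_argmins_measurable Sup_argmins_measurable)
  have LRi: "integral\<^sup>L M (?L m) \<le> integral\<^sup>L M (?R m)" if "m \<in> {0..E}" for m
    using Li Ri LR that by (intro integral_mono) auto
  have L_le_E: "integral\<^sup>L M (?L m) \<le> E" if "m \<in> {0..E}" for m
    using L[OF that] Li[OF that] by (intro integral_le_const AE_I2) auto
  define A where "A = {m \<in> {0..E}. m \<le> integral\<^sup>L M (?R m)}"
  have "0 \<in> A"
    using R[of 0] E by (auto simp: A_def intro!: Bochner_Integration.integral_nonneg)
  have bdd: "bdd_above A"
    by (auto simp: A_def intro: bdd_aboveI)
  define m where "m = Sup A"
  have mE: "m \<in> {0..E}"
    unfolding m_def using \<open>0 \<in> A\<close> bdd
    by (auto intro!: cSup_upper cSup_least simp: A_def)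
  have "m \<in> closure A"
    unfolding m_def using \<open>0 \<in> A\<close> bdd by (intro closure_contains_Sup) auto
  then obtain s where s: "\<And>n. s n \<in> A" "s \<longlonglongrightarrow> m"
    by (auto simp: closure_sequential)
  \<comment> \<open>Upper semicontinuity of the integral of \<open>?R\<close>: the reflected problem
    has least minimiser \<open>E - ?R\<close>, and membership of \<open>s n\<close> in
    \<open>A\<close> bounds its integral by \<open>E - s n\<close>. In the limit \<open>m\<close>
    itself satisfies the condition defining \<open>A\<close>.\<close>
  have "integral\<^sup>L M (\<lambda>\<omega>. Inf (argmins {0..E} (\<lambda>e. F \<omega> (E - e, m)))) \<le> E - m"
  proof (rule integral_Inf_argmins_le_limit[where F = "\<lambda>\<omega> (e, m). F \<omega> (E - e, m)", simplified])
    show "continuous_on ({0..E} \<times> {0..E}) (\<lambda>(e, m). F \<omega> (E - e, m))" if "\<omega> \<in> space M" for \<omega>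
      unfolding case_prod_unfold
      using that by (intro continuous_on_compose2[OF cont]) (auto intro!: continuous_intros)
    show "(\<integral>\<omega>. Inf (argmins {0..E} (\<lambda>e. F \<omega> (E - e, s n))) \<partial>M) \<le> E - s n" for n
    proof -
      have sn: "s n \<in> {0..E}" using s(1) by (auto simp: A_def)
      have "(\<integral>\<omega>. Inf (argmins {0..E} (\<lambda>e. F \<omega> (E - e, s n))) \<partial>M) = (\<integral>\<omega>. E - ?R (s n) \<omega> \<partial>M)"
        using E cm[OF sn] by (intro Bochner_Integration.integral_cong refl Inf_argmins_reflect)
      also have "\<dots> = E - integral\<^sup>L M (?R (s n))"
        using Ri[OF sn] by (simp add: prob_space)
      finally show ?thesis using s(1)[of n] by (simp add: A_def)
    qed
    show "(\<lambda>n. E - s n) \<longlonglongrightarrow> E - m"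
      by (intro tendsto_intros s)
  qed (use E meas s mE in \<open>auto simp: A_def\<close>)
  also have "integral\<^sup>L M (\<lambda>\<omega>. Inf (argmins {0..E} (\<lambda>e. F \<omega> (E - e, m)))) = (\<integral>\<omega>. E - ?R m \<omega> \<partial>M)"
    using E cm[OF mE] by (intro Bochner_Integration.integral_cong refl Inf_argmins_reflect)
  also have "\<dots> = E - integral\<^sup>L M (?R m)"
    using Ri[OF mE] by (simp add: prob_space)
  finally have mR: "m \<le> integral\<^sup>L M (?R m)" by simp
  have "integral\<^sup>L M (?L m) \<le> m"
  \<comment> \<open>The argument approaches \<open>m\<close> from the right. For
    \<open>m = E\<close> there is no room to do so, but there the trivial bound by \<open>E\<close>
    is already the claim.\<close>
  proof (cases "m = E")
    case True
    then show ?thesis using L_le_E[OF mE] by simp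
  next
    case False
    \<comment> \<open>These points lie in \<open>{0..E}\<close>, above \<open>Sup A\<close>, and
      decrease to \<open>m\<close>. Being outside \<open>A\<close>, each bounds the integral of
      \<open>?R\<close>, hence that of \<open>?L\<close>, by \<open>r n\<close>, and lower
      semicontinuity carries the bound to \<open>m\<close>.\<close>
    define r where "r n = m + (E - m) / real (Suc n)" for n
    have r: "m < r n" "r n \<le> E" for n
      using mE False divide_left_mono[of 1 "real (Suc n)" "E - m"] by (auto simp: r_def)
    then have rE: "r n \<in> {0..E}" for n
      using mE less_imp_le order_trans by (metis atLeastAtMost_iff)
    have rlim: "r \<longlonglongrightarrow> m"
      unfolding r_def by real_asymp
    show ?thesis
    proof (rule integral_Inf_argmins_le_limit[OF E cont meas rE rlim mE _ rlim])
      fix n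
      have "r n \<notin> A"
        using r(1)[of n] cSup_upper[OF _ bdd] unfolding m_def by force
      then show "integral\<^sup>L M (?L (r n)) \<le> r n"
        using rE[of n] LRi[of "r n"] by (auto simp: A_def)
    qed
  qed
  then show ?thesis using mE mR that by blast
qed

section \<open>Realising a prescribed mean by interpolation\<close>

lemma argmins_min:
  fixes f g :: "'a \<Rightarrow> real"
  assumes "argmins S f \<noteq> {}" "argmins S g \<noteq> {}"
  shows "argmins S (\<lambda>e. min (f e) (g e)) =
    (if (INF e\<in>S. f e) < (INF e\<in>S. g e) then argmins S f
     else if (INF e\<in>S. g e) < (INF e\<in>S. f e) then argmins S g
     else argmins S f \<union> argmins S g)"
proof -
  obtain a b where ab: "a \<in> argmins S f" "b \<in> argmins S g"
    using assms by auto
  have a: "a \<in> S" "\<And>e. e \<in> S \<Longrightarrow> f a \<le> f e" and b: "b \<in> S" "\<And>e. e \<in> S \<Longrightarrow> g b \<le> g e"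
    using ab by (auto simp: argmins_def)
  have f: "argmins S f = {e \<in> S. f e \<le> f a}"
    using a by (force simp: argmins_def)
  have g: "argmins S g = {e \<in> S. g e \<le> g b}"
    using b by (force simp: argmins_def)
  have fg: "argmins S (\<lambda>e. min (f e) (g e)) = {e \<in> S. min (f e) (g e) \<le> min (f a) (g b)}"
    using a b by (auto simp: argmins_def min_le_iff_disj) (meson order_trans)+
  show ?thesis
    unfolding fg unfolding f g argmins_value[OF ab(1)] argmins_value[OF ab(2)]
    using a(2) b(2) by (force simp: min_def)
qed

text \<open>The minimum of two convex functions need not be convex, so its minimisers cannot be
  interpolated directly. Instead \<open>u\<close> and \<open>v\<close> move inside the convex
  minimiser sets of \<open>f\<close> and \<open>g\<close> separately, and the mixing weight
  \<open>q\<close> bridges the gap between the two sets.\<close>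

lemma (in prob_space) ex_profile_with_mean:
  fixes f g :: "'a \<Rightarrow> real \<Rightarrow> real"
  assumes E: "0 \<le> E"
    and contf: "\<And>\<omega>. \<omega> \<in> space M \<Longrightarrow> continuous_on {0..E} (f \<omega>)"
    and contg: "\<And>\<omega>. \<omega> \<in> space M \<Longrightarrow> continuous_on {0..E} (g \<omega>)"
    and convf: "\<And>\<omega>. \<omega> \<in> space M \<Longrightarrow> convex_on {0..E} (f \<omega>)"
    and convg: "\<And>\<omega>. \<omega> \<in> space M \<Longrightarrow> convex_on {0..E} (g \<omega>)"
    and measf: "\<And>e. e \<in> {0..E} \<Longrightarrow> (\<lambda>\<omega>. f \<omega> e) \<in> borel_measurable M"
    and measg: "\<And>e. e \<in> {0..E} \<Longrightarrow> (\<lambda>\<omega>. g \<omega> e) \<in> borel_measurable M"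
    and lo: "(\<integral>\<omega>. Inf (argmins {0..E} (\<lambda>e. min (f \<omega> e) (g \<omega> e))) \<partial>M) \<le> m"
    and hi: "m \<le> (\<integral>\<omega>. Sup (argmins {0..E} (\<lambda>e. min (f \<omega> e) (g \<omega> e))) \<partial>M)"
  obtains u v q where
    "u \<in> borel_measurable M" "v \<in> borel_measurable M" "q \<in> borel_measurable M"
    "\<And>\<omega>. \<omega> \<in> space M \<Longrightarrow> u \<omega> \<in> argmins {0..E} (f \<omega>)"
    "\<And>\<omega>. \<omega> \<in> space M \<Longrightarrow> v \<omega> \<in> argmins {0..E} (g \<omega>)"
    "\<And>\<omega>. \<omega> \<in> space M \<Longrightarrow> q \<omega> \<in> {0..1}"
    "\<And>\<omega>. \<omega> \<in> space M \<Longrightarrow> f \<omega> (u \<omega>) < g \<omega> (v \<omega>) \<Longrightarrow> q \<omega> = 1"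
    "\<And>\<omega>. \<omega> \<in> space M \<Longrightarrow> g \<omega> (v \<omega>) < f \<omega> (u \<omega>) \<Longrightarrow> q \<omega> = 0"
    "m = (\<integral>\<omega>. q \<omega> * u \<omega> + (1 - q \<omega>) * v \<omega> \<partial>M)"
proof -
  define F G where "F \<omega> = argmins {0..E} (f \<omega>)" and "G \<omega> = argmins {0..E} (g \<omega>)" for \<omega>
  define Vf Vg where "Vf \<omega> = (INF e\<in>{0..E}. f \<omega> e)" and "Vg \<omega> = (INF e\<in>{0..E}. g \<omega> e)" for \<omega>
  \<comment> \<open>At a tie of the minimal values, \<open>qL\<close> picks the option with the
    smaller least minimiser and \<open>qR\<close> the one with the larger greatest minimiser.
    Elsewhere the two agree, so every interpolation between them keeps the forced value 0 or
    1.\<close>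
  define qL where "qL \<omega> = (if Vf \<omega> < Vg \<omega> then 1 else if Vg \<omega> < Vf \<omega> then 0
      else if Inf (F \<omega>) \<le> Inf (G \<omega>) then 1 else (0::real))" for \<omega>
  define qR where "qR \<omega> = (if Vf \<omega> < Vg \<omega> then 1 else if Vg \<omega> < Vf \<omega> then 0
      else if Sup (G \<omega>) \<le> Sup (F \<omega>) then 1 else (0::real))" for \<omega>
  have [measurable]: "Vf \<in> borel_measurable M" "Vg \<in> borel_measurable M"
    unfolding Vf_def Vg_def using E contf contg measf measg
    by (auto intro!: borel_measurable_INF_compact)
  have [measurable]: "(\<lambda>\<omega>. Inf (F \<omega>)) \<in> borel_measurable M" "(\<lambda>\<omega>. Inf (G \<omega>)) \<in> borel_measurable M"
    "(\<lambda>\<omega>. Sup (F \<omega>)) \<in> borel_measurable M" "(\<lambda>\<omega>. Sup (G \<omega>)) \<in> borel_measurable M"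
    unfolding F_def G_def using E contf contg measf measg
    by (auto intro!: Inf_argmins_measurable Sup_argmins_measurable)
  have [measurable]: "qL \<in> borel_measurable M" "qR \<in> borel_measurable M"
    unfolding qL_def qR_def by measurable
  have in_F: "Inf (F \<omega>) \<in> F \<omega>" "Sup (F \<omega>) \<in> F \<omega>" "bdd_below (F \<omega>)" "bdd_above (F \<omega>)"
    and in_G: "Inf (G \<omega>) \<in> G \<omega>" "Sup (G \<omega>) \<in> G \<omega>" "bdd_below (G \<omega>)" "bdd_above (G \<omega>)"
    if "\<omega> \<in> space M" for \<omega>
    using E contf[OF that] contg[OF that] unfolding F_def G_def
    by (auto intro!: Inf_argmins_in Sup_argmins_in bdd_below_argmins bdd_above_argmins)
  have FE: "F \<omega> \<subseteq> {0..E}" and GE: "G \<omega> \<subseteq> {0..E}" for \<omega>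
    by (auto simp: F_def G_def argmins_def)
  define u where "u t \<omega> = (1 - t) * Inf (F \<omega>) + t * Sup (F \<omega>)" for t \<omega>
  define v where "v t \<omega> = (1 - t) * Inf (G \<omega>) + t * Sup (G \<omega>)" for t \<omega>
  define q where "q t \<omega> = (1 - t) * qL \<omega> + t * qR \<omega>" for t \<omega>
  have [measurable]: "u t \<in> borel_measurable M" "v t \<in> borel_measurable M" "q t \<in> borel_measurable M" for t
    unfolding u_def v_def q_def by measurable
  have u: "u t \<omega> \<in> F \<omega>" and v: "v t \<omega> \<in> G \<omega>" and q: "q t \<omega> \<in> {0..1}"
    if "t \<in> {0..1}" "\<omega> \<in> space M" for t \<omega>
  proof -
    show "u t \<omega> \<in> F \<omega>"
      using convexD[OF convex_argmins[OF convf[OF that(2)]], of "Inf (F \<omega>)" "Sup (F \<omega>)" "1 - t" t]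
        in_F[OF that(2)] that(1) by (simp add: u_def F_def)
    show "v t \<omega> \<in> G \<omega>"
      using convexD[OF convex_argmins[OF convg[OF that(2)]], of "Inf (G \<omega>)" "Sup (G \<omega>)" "1 - t" t]
        in_G[OF that(2)] that(1) by (simp add: v_def G_def)
    show "q t \<omega> \<in> {0..1}"
      using that(1) by (auto simp: q_def qL_def qR_def)
  qed
  define h where "h t \<omega> = q t \<omega> * u t \<omega> + (1 - q t \<omega>) * v t \<omega>" for t \<omega>
  have [measurable]: "h t \<in> borel_measurable M" for t
    unfolding h_def by measurable
  have min_eq: "argmins {0..E} (\<lambda>e. min (f \<omega> e) (g \<omega> e)) =
      (if Vf \<omega> < Vg \<omega> then F \<omega> else if Vg \<omega> < Vf \<omega> then G \<omega> else F \<omega> \<union> G \<omega>)"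
    if "\<omega> \<in> space M" for \<omega>
    unfolding Vf_def Vg_def F_def G_def
    using in_F[OF that] in_G[OF that] by (intro argmins_min) (auto simp: F_def G_def)
  have h0: "h 0 \<omega> = Inf (argmins {0..E} (\<lambda>e. min (f \<omega> e) (g \<omega> e)))" if "\<omega> \<in> space M" for \<omega>
  proof -
    have "Inf (F \<omega> \<union> G \<omega>) = min (Inf (F \<omega>)) (Inf (G \<omega>))"
      using in_F[OF that] in_G[OF that] by (subst cInf_union_distrib) (auto simp: inf_min)
    then show ?thesis
      by (auto simp: min_eq[OF that] h_def q_def u_def v_def qL_def)
  qed
  have h1: "h 1 \<omega> = Sup (argmins {0..E} (\<lambda>e. min (f \<omega> e) (g \<omega> e)))" if "\<omega> \<in> space M" for \<omega>
  proof -
    have "Sup (F \<omega> \<union> G \<omega>) = max (Sup (F \<omega>)) (Sup (G \<omega>))"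
      using in_F[OF that] in_G[OF that] by (subst cSup_union_distrib) (auto simp: sup_max)
    then show ?thesis
      by (auto simp: min_eq[OF that] h_def q_def u_def v_def qR_def)
  qed
  have "continuous_on {0..1} (\<lambda>t. integral\<^sup>L M (h t))"
  proof (intro continuous_on_sequentiallyI)
    fix t s assume s: "\<forall>n. s n \<in> {0..1::real}" "t \<in> {0..1}" "s \<longlonglongrightarrow> t"
    show "(\<lambda>n. integral\<^sup>L M (h (s n))) \<longlonglongrightarrow> integral\<^sup>L M (h t)"
    \<comment> \<open>For fixed \<open>\<omega>\<close> the mixed effort is a polynomial in
      \<open>t\<close>. The dominating constant \<open>E + E\<close> comes from bounding its two
      summands by \<open>E\<close> separately.\<close>
    proof (rule integral_dominated_convergence[where w = "\<lambda>_. E + E"])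
      show "AE \<omega> in M. (\<lambda>n. h (s n) \<omega>) \<longlonglongrightarrow> h t \<omega>"
        unfolding h_def q_def u_def v_def by (intro AE_I2 tendsto_intros s)
      show "AE \<omega> in M. norm (h (s n) \<omega>) \<le> E + E" for n
      proof (rule AE_I2)
        fix \<omega> assume \<omega>: "\<omega> \<in> space M"
        have b: "u (s n) \<omega> \<in> {0..E}" "v (s n) \<omega> \<in> {0..E}" "q (s n) \<omega> \<in> {0..1}"
          using u[OF s(1)[rule_format] \<omega>] v[OF s(1)[rule_format] \<omega>] q[OF s(1)[rule_format] \<omega>] FE GE
          by blast+
        then have "0 \<le> q (s n) \<omega> * u (s n) \<omega>" "0 \<le> (1 - q (s n) \<omega>) * v (s n) \<omega>"
          by auto
        moreover have "q (s n) \<omega> * u (s n) \<omega> \<le> 1 * E" "(1 - q (s n) \<omega>) * v (s n) \<omega> \<le> 1 * E"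
          using b by (intro mult_mono; simp)+
        ultimately show "norm (h (s n) \<omega>) \<le> E + E"
          by (simp add: h_def)
      qed
    qed auto
  qed
  moreover have "integral\<^sup>L M (h 0) \<le> m" "m \<le> integral\<^sup>L M (h 1)"
    using lo hi h0 h1 by (simp_all cong: Bochner_Integration.integral_cong)
  ultimately obtain t where t: "t \<in> {0..1}" "integral\<^sup>L M (h t) = m"
    using IVT'[of "\<lambda>t. integral\<^sup>L M (h t)" 0 m 1] by auto
  \<comment> \<open>The attained values do not depend on \<open>t\<close>, so the conditions on
    \<open>q\<close> reduce to comparing \<open>Vf\<close> with \<open>Vg\<close>.\<close>
  have val: "f \<omega> (u t \<omega>) = Vf \<omega>" "g \<omega> (v t \<omega>) = Vg \<omega>" if "\<omega> \<in> space M" for \<omega>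
    using argmins_value[OF u[OF t(1) that, unfolded F_def]] argmins_value[OF v[OF t(1) that, unfolded G_def]]
    by (simp_all add: Vf_def Vg_def)
  show ?thesis
  proof (rule that[of "u t" "v t" "q t"])
    show "m = (\<integral>\<omega>. q t \<omega> * u t \<omega> + (1 - q t \<omega>) * v t \<omega> \<partial>M)"
      using t(2) by (simp add: h_def[abs_def])
    show "q t \<omega> = 1" if "\<omega> \<in> space M" "f \<omega> (u t \<omega>) < g \<omega> (v t \<omega>)" for \<omega>
      using that by (simp add: val q_def qL_def qR_def)
    show "q t \<omega> = 0" if "\<omega> \<in> space M" "g \<omega> (v t \<omega>) < f \<omega> (u t \<omega>)" for \<omega>
      using that by (simp add: val q_def qL_def qR_def)
  qed (use u[OF t(1), unfolded F_def] v[OF t(1), unfolded G_def] q[OF t(1)] in simp_all)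
qed

section \<open>Existence of mean-field equilibria\<close>

lemma convex_on_shift:
  fixes h :: "real \<Rightarrow> real"
  assumes h: "convex_on {0..(1 + x) * E} h" and x: "0 \<le> x" and m: "m \<in> {0..E}"
  shows "convex_on {0..E} (\<lambda>e. h (e + x * m))"
proof (rule convex_onI)
  fix t a b :: real
  assume t: "0 < t" "t < 1" and ab: "a \<in> {0..E}" "b \<in> {0..E}"
  have "0 \<le> x * m" "x * m \<le> x * E"
    using x m by (auto intro: mult_left_mono)
  then have "a + x * m \<in> {0..(1 + x) * E}" "b + x * m \<in> {0..(1 + x) * E}"
    using ab by (auto simp: algebra_simps)
  then have "h ((1 - t) *\<^sub>R (a + x * m) + t *\<^sub>R (b + x * m))
      \<le> (1 - t) * h (a + x * m) + t * h (b + x * m)"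
    using t by (intro convex_onD[OF h]) auto
  then show "h ((1 - t) *\<^sub>R a + t *\<^sub>R b + x * m) \<le> (1 - t) * h (a + x * m) + t * h (b + x * m)"
    by (simp add: algebra_simps)
qed simp

lemma continuous_on_shift:
  fixes h :: "real \<Rightarrow> real"
  assumes h: "continuous_on {0..(1 + x) * E} h" and x: "0 \<le> x"
  shows "continuous_on ({0..E} \<times> {0..E}) (\<lambda>z. h (fst z + x * snd z))"
proof (rule continuous_on_compose2[OF h])
  show "(\<lambda>z. fst z + x * snd z) ` ({0..E} \<times> {0..E}) \<subseteq> {0..(1 + x) * E}"
    using x by (auto simp: distrib_right intro!: add_mono mult_left_mono)
qed (intro continuous_intros)

text \<open>The mean effort is found for the pointwise minimum of \<open>CE_in\<close> and
  \<open>CE_out\<close>; at that mean effort the two costs are interpolated separately. The bound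
  \<open>\<beta> \<le> 1\<close> keeps the coefficient of \<open>\<mu>\<close> in
  \<open>CE_in\<close> nonnegative, which its convexity in effort rests on.\<close>

lemma mf_equilibria_nonempty:
  assumes prob: "prob_space \<pi>" and x: "0 \<le> x" and E: "0 \<le> E"
    and mu: "continuous_on {0..(1 + x) * E} \<mu>" "convex_on {0..(1 + x) * E} \<mu>"
    and lam: "continuous_on {0..(1 + x) * E} lam" "convex_on {0..(1 + x) * E} lam"
    and meas: "\<gamma>_of \<in> borel_measurable \<pi>" "c_of \<in> borel_measurable \<pi>" "\<sigma>_of \<in> borel_measurable \<pi>"
    and gamma: "\<And>\<theta>. \<theta> \<in> space \<pi> \<Longrightarrow> 0 < \<gamma>_of \<theta>"
    and \<beta>: "\<beta> \<le> 1"
  shows "mf_equilibria \<pi> \<mu> lam x E (p, \<alpha>, \<beta>) \<noteq> {}"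
proof -
  interpret prob_space \<pi> by (rule prob)
  note [measurable] = meas
  let ?k = "(p, \<alpha>, \<beta>)"
  let ?f = "\<lambda>\<theta> (e, m). CE_in \<mu> lam x ?k e \<theta> m"
  let ?g = "\<lambda>\<theta> (e, m). CE_out \<mu> lam x e \<theta> m"
  have cont: "continuous_on ({0..E} \<times> {0..E}) (?f \<theta>)" "continuous_on ({0..E} \<times> {0..E}) (?g \<theta>)" for \<theta>
    unfolding case_prod_unfold CE_in.simps CE_out_def
    by (intro continuous_intros continuous_on_shift mu lam x)+
  have measf: "(\<lambda>\<theta>. CE_in \<mu> lam x ?k e \<theta> m) \<in> borel_measurable \<pi>"
    and measg: "(\<lambda>\<theta>. CE_out \<mu> lam x e \<theta> m) \<in> borel_measurable \<pi>" for e m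
    unfolding CE_in.simps CE_out_def by measurable
  obtain m where m: "m \<in> {0..E}"
    "(\<integral>\<theta>. Inf (argmins {0..E} (\<lambda>e. min (?f \<theta> (e, m)) (?g \<theta> (e, m)))) \<partial>\<pi>) \<le> m"
    "m \<le> (\<integral>\<theta>. Sup (argmins {0..E} (\<lambda>e. min (?f \<theta> (e, m)) (?g \<theta> (e, m)))) \<partial>\<pi>)"
  proof (rule ex_mean_between_integrals[where F = "\<lambda>\<theta> z. min (?f \<theta> z) (?g \<theta> z)", OF E])
    show "continuous_on ({0..E} \<times> {0..E}) (\<lambda>z. min (?f \<theta> z) (?g \<theta> z))" for \<theta>
      by (intro continuous_on_min cont)
    show "(\<lambda>\<theta>. min (?f \<theta> (e, m)) (?g \<theta> (e, m))) \<in> borel_measurable \<pi>" for e m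
      using measf measg by simp
  qed
  have conv: "convex_on {0..E} (\<lambda>e. CE_in \<mu> lam x ?k e \<theta> m)"
    "convex_on {0..E} (\<lambda>e. CE_out \<mu> lam x e \<theta> m)" if "\<theta> \<in> space \<pi>" for \<theta>
  proof -
    note shift = convex_on_shift[OF mu(2) x m(1)] convex_on_shift[OF lam(2) x m(1)]
    have lin: "convex_on {0..E} (\<lambda>e. a * e + b)" for a b :: real
      by (rule convex_onI) (auto simp: algebra_simps)
    \<comment> \<open>The cost is regrouped as an affine function of effort plus nonnegative
      multiples of the shifted \<open>\<mu>\<close> and \<open>lam\<close>.\<close>
    have "convex_on {0..E} (\<lambda>e. ((c_of \<theta> - \<alpha>) * e + (p + 1/2 * \<gamma>_of \<theta> * \<alpha>\<^sup>2 * (\<sigma>_of \<theta>)\<^sup>2))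
        + (1 - \<beta>) * \<mu> (e + x * m) + (1/2 * \<gamma>_of \<theta> * (1 - \<beta>)\<^sup>2) * lam (e + x * m))"
      using gamma[OF that] \<beta>
      by (intro convex_on_add convex_on_cmul lin shift) auto
    then show "convex_on {0..E} (\<lambda>e. CE_in \<mu> lam x ?k e \<theta> m)"
      by (simp add: algebra_simps)
    have "convex_on {0..E} (\<lambda>e. (c_of \<theta> * e + 0) + \<mu> (e + x * m) + (1/2 * \<gamma>_of \<theta>) * lam (e + x * m))"
      using gamma[OF that]
      by (intro convex_on_add convex_on_cmul lin shift) auto
    then show "convex_on {0..E} (\<lambda>e. CE_out \<mu> lam x e \<theta> m)"
      by (simp add: CE_out_def algebra_simps)
  qed
  have cm: "continuous_on {0..E} (\<lambda>e. CE_in \<mu> lam x ?k e \<theta> m)"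
    "continuous_on {0..E} (\<lambda>e. CE_out \<mu> lam x e \<theta> m)" for \<theta>
  proof -
    have emb: "continuous_on {0..E} (\<lambda>e. (e, m))" "(\<lambda>e. (e, m)) ` {0..E} \<subseteq> {0..E} \<times> {0..E}"
      using m(1) by (auto intro!: continuous_intros)
    show "continuous_on {0..E} (\<lambda>e. CE_in \<mu> lam x ?k e \<theta> m)"
      "continuous_on {0..E} (\<lambda>e. CE_out \<mu> lam x e \<theta> m)"
      using continuous_on_compose2[OF cont(1) emb] continuous_on_compose2[OF cont(2) emb]
      unfolding prod.case by blast+
  qed
  obtain u v q where prof:
    "u \<in> borel_measurable \<pi>" "v \<in> borel_measurable \<pi>" "q \<in> borel_measurable \<pi>"
    "\<And>\<theta>. \<theta> \<in> space \<pi> \<Longrightarrow> u \<theta> \<in> argmins {0..E} (\<lambda>e. CE_in \<mu> lam x ?k e \<theta> m)"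
    "\<And>\<theta>. \<theta> \<in> space \<pi> \<Longrightarrow> v \<theta> \<in> argmins {0..E} (\<lambda>e. CE_out \<mu> lam x e \<theta> m)"
    "\<And>\<theta>. \<theta> \<in> space \<pi> \<Longrightarrow> q \<theta> \<in> {0..1}"
    "\<And>\<theta>. \<theta> \<in> space \<pi> \<Longrightarrow> CE_in \<mu> lam x ?k (u \<theta>) \<theta> m < CE_out \<mu> lam x (v \<theta>) \<theta> m \<Longrightarrow> q \<theta> = 1"
    "\<And>\<theta>. \<theta> \<in> space \<pi> \<Longrightarrow> CE_out \<mu> lam x (v \<theta>) \<theta> m < CE_in \<mu> lam x ?k (u \<theta>) \<theta> m \<Longrightarrow> q \<theta> = 0"
    and mean: "m = (\<integral>\<theta>. q \<theta> * u \<theta> + (1 - q \<theta>) * v \<theta> \<partial>\<pi>)"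
    using ex_profile_with_mean[OF E cm conv measf measg m(2,3)[unfolded prod.case]] by blast
  have "\<lparr>mean_effort = m, eff_in = u, eff_out = v, participation = q\<rparr>
      \<in> mf_equilibria \<pi> \<mu> lam x E ?k"
    unfolding mf_equilibria_def Let_def mem_Collect_eq mf_profile.simps
  proof (intro conjI ballI impI m(1) mean)
    fix \<theta> assume \<theta>: "\<theta> \<in> space \<pi>"
    \<comment> \<open>Since \<open>\<gamma>_of \<theta>\<close> is positive, utility is strictly
      decreasing in the certainty equivalent, so the inequality between utilities reverses.\<close>
    show "q \<theta> = 1" if "U_in \<mu> lam x ?k (u \<theta>) \<theta> m > U_out \<mu> lam x (v \<theta>) \<theta> m"
      using that gamma[OF \<theta>] by (intro prof(7) \<theta>) (simp add: U_in_def U_out_def del: CE_in.simps)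
    show "q \<theta> = 0" if "U_in \<mu> lam x ?k (u \<theta>) \<theta> m < U_out \<mu> lam x (v \<theta>) \<theta> m"
      using that gamma[OF \<theta>] by (intro prof(8) \<theta>) (simp add: U_in_def U_out_def del: CE_in.simps)
  qed (simp_all only: prof E_in_def E_out_def is_arg_min_iff_argmins mem_Collect_eq)
  then show ?thesis by blast
qed

section \<open>Approximately optimal contracts\<close>

theorem theorem4p1:
  fixes x E_max p_max \<alpha>_max \<beta>_max \<gamma>_max c_max \<sigma>_max :: real
    and \<pi> :: "agent_type measure"
    and \<mu> lam :: "real \<Rightarrow> real"
    and K :: "contract set"
    and J :: "contract \<Rightarrow> real"
  assumes x: "0 \<le> x" "x < 1"
    and prob: "prob_space \<pi>"
    and lam_nonneg: "\<And>y. 0 \<le> y \<Longrightarrow> 0 \<le> lam y"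
    and I1: "0 \<le> p_max" "0 \<le> \<alpha>_max" "0 \<le> \<beta>_max" "\<beta>_max < 1"
    and K: "K = contracts p_max \<alpha>_max \<beta>_max"
    and E_max: "0 \<le> E_max"
    and mu: "continuous_on {0..(1 + x) * E_max} \<mu>" "convex_on {0..(1 + x) * E_max} \<mu>"
    and lam: "continuous_on {0..(1 + x) * E_max} lam" "convex_on {0..(1 + x) * E_max} lam"
    and meas: "\<gamma>_of \<in> borel_measurable \<pi>" "c_of \<in> borel_measurable \<pi>" "\<sigma>_of \<in> borel_measurable \<pi>"
    and max_pos: "0 < \<gamma>_max" "0 < c_max" "0 < \<sigma>_max"
    and gamma_bounds: "\<And>\<theta>. \<theta> \<in> space \<pi> \<Longrightarrow> 0 < \<gamma>_of \<theta> \<and> \<gamma>_of \<theta> \<le> \<gamma>_max"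
    and c_bounds: "\<And>\<theta>. \<theta> \<in> space \<pi> \<Longrightarrow> 0 \<le> c_of \<theta> \<and> c_of \<theta> \<le> c_max"
    and sigma_bounds: "\<And>\<theta>. \<theta> \<in> space \<pi> \<Longrightarrow> 0 \<le> \<sigma>_of \<theta> \<and> \<sigma>_of \<theta> \<le> \<sigma>_max"
    and criterion: "performance_criterion K J"
    and bdd: "bdd_above (J ` K)"
  shows "(\<forall>k\<in>K. mf_equilibria \<pi> \<mu> lam x E_max k \<noteq> {}) \<and>
         (\<forall>\<epsilon>>0. \<exists>k\<^sub>\<epsilon>\<in>K. J k\<^sub>\<epsilon> \<ge> (SUP k\<in>K. J k) - \<epsilon> \<and>
            mf_equilibria \<pi> \<mu> lam x E_max k\<^sub>\<epsilon> \<noteq> {})"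
proof -
  have eq: "mf_equilibria \<pi> \<mu> lam x E_max k \<noteq> {}" if "k \<in> K" for k
  proof -
    obtain p \<alpha> \<beta> where k: "k = (p, \<alpha>, \<beta>)" by (cases k)
    show ?thesis
      unfolding k
    proof (rule mf_equilibria_nonempty[OF prob x(1) E_max mu lam meas])
      show "0 < \<gamma>_of \<theta>" if "\<theta> \<in> space \<pi>" for \<theta>
        using gamma_bounds[OF that] by simp
      show "\<beta> \<le> 1"
        using that I1 by (simp add: k K contracts_def)
    qed
  qed
  have "K \<noteq> {}"
    using I1 by (simp add: K contracts_def)
  \<comment> \<open>The number \<open>(SUP k\<in>K. J k) - \<epsilon>\<close> lies strictly below
    the supremum of a nonempty set bounded above, so some value of \<open>J\<close> exceeds
    it.\<close>
  have "\<exists>k\<in>K. (SUP k\<in>K. J k) - \<epsilon> \<le> J k" if "0 < \<epsilon>" for \<epsilon>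
    using that less_cSUP_iff[OF \<open>K \<noteq> {}\<close> bdd, of "(SUP k\<in>K. J k) - \<epsilon>"] by (auto intro: less_imp_le)
  then show ?thesis using eq by blast
qed

end
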